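(* For every $\varepsilon>0$ there exist a prime $p_\varepsilon$ and a function $f$ on primes with $f(p)\le 1/2$ and $f(p)\to0$ as $p\to\infty$, such that for all primes $p\ge p_\varepsilon$, all integers $N\ge1$ and all $\alpha\in\mathscr B(p,N)$ with $\mathfrak d_{p,N}(\alpha,O)\ge f(p)$ (where $O=0$ is the origin), \[ \frac{1}{\#\mathcal V(p,N)}\#\big\{\beta\in\mathcal V(p,N): |\cos(\widehat{\alpha O\beta})|\le\varepsilon\big\}\ \ge\ 1-\varepsilon . \]
   Context: Let $p$ be an odd prime, $\omega=\exp(2\pi i/p)$, and $\mathbb{Q}(\omega)$ the $p$-th cyclotomic field, with $\mathbb{Q}$-basis $\omega,\dots,\omega^{p-1}$. For $\gamma\in\mathbb{Q}(\omega)$, $\mathrm{Tr}(\gamma)=\sum_{\sigma\in\mathrm{Gal}(\mathbb{Q}(\omega)/\mathbb{Q})}\sigma(\gamma)$. Let $\psi(\gamma)=(\mathrm{Tr}(\gamma\omega),\dots,\mathrm{Tr}(\gamma\omega^{p-1}))\in\mathbb{Q}^{p-1}$, $\|\gamma\|$ the Euclidean norm of $\psi(\gamma)$, $d(\alpha,\beta)=\|\beta-\alpha\|$, and $\mathfrak d_{p,N}(\alpha,\beta)=d(\alpha,\beta)/(2Np(p-1)^{1/2})$. For an integer $N\ge1$, $\mathscr B(p,N)=\{\sum_{j=1}^{p-1}a_j\omega^j: a_j\in[-N,N]\cap\mathbb{Z}\}$ and $\mathcal V(p,N)=\{\sum_{j=1}^{p-1}a_j\omega^j: a_j\in\{-N,N\}\}$.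 The angle $\widehat{\alpha O\beta}$ is the angle at $O$ in this metric (equivalently the Euclidean angle between $\psi(\alpha)$ and $\psi(\beta)$), so $\cos(\widehat{\alpha O\beta})=\dfrac{\mathfrak d_{p,N}(O,\alpha)^2+\mathfrak d_{p,N}(O,\beta)^2-\mathfrak d_{p,N}(\alpha,\beta)^2}{2\,\mathfrak d_{p,N}(O,\alpha)\,\mathfrak d_{p,N}(O,\beta)}$. *)

theory Defs
  imports "HOL-Analysis.Analysis" "HOL-Computational_Algebra.Primes"
begin

definition zeta :: "nat \<Rightarrow> complex" where
  "zeta p = exp (2 * of_real pi * \<i> / of_nat p)"

definition is_subfield :: "'a :: field set \<Rightarrow> bool" where
  "is_subfield K \<longleftrightarrow> 1 \<in> K \<and> (\<forall>x\<in>K. \<forall>y\<in>K. x - y \<in> K \<and> x * y \<in> K) \<and> (\<forall>x\<in>K. inverse x \<in> K)"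

(* Every subfield of the complex numbers contains the rationals, so this is Q(zeta p). *)
definition cyclotomic_field :: "nat \<Rightarrow> complex set" where
  "cyclotomic_field p = is_subfield hull {zeta p}"

(* Restricting to extensional functions makes every automorphism of K occur exactly once,
   so that sums over Gal(K/Q) are correct. *)
definition Gal_Q :: "complex set \<Rightarrow> (complex \<Rightarrow> complex) set" where
  "Gal_Q K = {\<sigma> \<in> extensional K. bij_betw \<sigma> K K \<and>
     (\<forall>x\<in>K. \<forall>y\<in>K. \<sigma> (x + y) = \<sigma> x + \<sigma> y \<and> \<sigma> (x * y) = \<sigma> x * \<sigma> y) \<and>
     (\<forall>q::rat. \<sigma> (of_rat q) = of_rat q)}"

definition Tr :: "nat \<Rightarrow> complex \<Rightarrow> complex" where
  "Tr p \<gamma> = (\<Sum>\<sigma>\<in>Gal_Q (cyclotomic_field p). \<sigma> \<gamma>)"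

(* The coordinates are indexed by j = 1, ..., p - 1. They are rational for \<gamma> in Q(zeta p), but
   kept as complex numbers. *)
definition psi :: "nat \<Rightarrow> complex \<Rightarrow> nat \<Rightarrow> complex" where
  "psi p \<gamma> j = Tr p (\<gamma> * zeta p ^ j)"

(* As the coordinates are rational, cmod is their absolute value and this is the
   Euclidean norm on Q^(p-1). *)
definition norm_cyc :: "nat \<Rightarrow> complex \<Rightarrow> real" where
  "norm_cyc p \<gamma> = L2_set (\<lambda>j. cmod (psi p \<gamma> j)) {1..p-1}"

definition dist_cyc :: "nat \<Rightarrow> complex \<Rightarrow> complex \<Rightarrow> real" where
  "dist_cyc p \<alpha> \<beta> = norm_cyc p (\<beta> - \<alpha>)"

definition ndist :: "nat \<Rightarrow> nat \<Rightarrow> complex \<Rightarrow> complex \<Rightarrow> real" where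
  "ndist p N \<alpha> \<beta> = dist_cyc p \<alpha> \<beta> / (2 * real N * real p * sqrt (real (p - 1)))"

definition cyc_box :: "nat \<Rightarrow> nat \<Rightarrow> complex set" where
  "cyc_box p N = {\<Sum>j=1..p-1. of_int (a j) * zeta p ^ j | a :: nat \<Rightarrow> int.
     \<forall>j\<in>{1..p-1}. a j \<in> {- int N..int N}}"

definition cyc_vertices :: "nat \<Rightarrow> nat \<Rightarrow> complex set" where
  "cyc_vertices p N = {\<Sum>j=1..p-1. of_int (a j) * zeta p ^ j | a :: nat \<Rightarrow> int.
     \<forall>j\<in>{1..p-1}. a j \<in> {- int N, int N}}"

(* The angle at P between A and B, by the law of cosines. If A = P or B = P the quotient is a
   division by zero, and the angle is pi/2 by convention. *)
definition cyc_angle :: "nat \<Rightarrow> nat \<Rightarrow> complex \<Rightarrow> complex \<Rightarrow> complex \<Rightarrow> real" where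
  "cyc_angle p N A P B = arccos (((ndist p N P A)\<^sup>2 + (ndist p N P B)\<^sup>2 - (ndist p N A B)\<^sup>2) /
     (2 * ndist p N P A * ndist p N P B))"

end

theory Submission
  imports Defs
begin

text \<open>
  If \<open>\<alpha>\<close> has coefficients \<open>a\<^sub>j\<close> with sum \<open>S\<close>, the coordinates of \<open>\<psi>(\<alpha>)\<close> are, up to order, the numbers
  \<open>u\<^sub>j = p a\<^sub>j - S\<close>; this uses that the Galois group consists of \<open>\<zeta> \<mapsto> \<zeta>\<^sup>k\<close> for \<open>0 < k < p\<close>, that is, the
  irreducibility of the cyclotomic polynomial. For a vertex \<open>\<beta>\<close> with coefficients \<open>b\<^sub>j = \<plusminus>N\<close>, the inner product of
  \<open>\<psi>(\<alpha>)\<close> and \<open>\<psi>(\<beta>)\<close> is the linear form with coefficients \<open>p u\<^sub>j - S\<close> in the \<open>b\<^sub>j\<close>, so over random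
  signs its second moment is at most \<open>N\<^sup>2 p\<^sup>2 \<parallel>\<alpha>\<parallel>\<^sup>2\<close>. On the other hand
  \<open>\<parallel>\<beta>\<parallel>\<^sup>2 = p\<^sup>2 (p - 1) N\<^sup>2 - (p + 1) (\<Sum> b\<^sub>j)\<^sup>2\<close>, where \<open>(\<Sum> b\<^sub>j)\<^sup>2\<close> has mean \<open>(p - 1) N\<^sup>2\<close>, so that
  \<open>\<parallel>\<beta>\<parallel>\<^sup>2 \<ge> p\<^sup>2 (p - 1) N\<^sup>2 / 2\<close> for most \<open>\<beta>\<close>. Markov's inequality for both quantities bounds the proportion of \<open>\<beta>\<close>
  with \<open>\<bar>cos\<bar> > \<epsilon>\<close> by \<open>6 / (\<epsilon>\<^sup>2 (p - 1))\<close>.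
\<close>

section \<open>Irreducibility of the cyclotomic polynomial\<close>

text \<open>Let \<open>i\<close> be least with \<open>coeff h i\<close> prime to \<open>p\<close>.
  In coefficient \<open>i\<close> of \<open>g * h\<close> every term except
  \<open>coeff g 0 * coeff h i\<close> is divisible by \<open>p\<close>, so the coefficient is not.
  But \<open>i\<close> is at most \<open>degree h\<close>, hence below \<open>degree (g * h)\<close>
  unless \<open>g\<close> is constant.\<close>

lemma eisenstein_aux:
  fixes g h :: "int poly" and p :: int
  assumes p: "prime p"
    and dvd: "\<And>i. i < degree (g * h) \<Longrightarrow> p dvd coeff (g * h) i"
    and lead: "\<not> p dvd lead_coeff (g * h)"
    and g0: "\<not> p dvd coeff g 0" and h0: "p dvd coeff h 0"
  shows "degree g = 0"
proof (rule ccontr)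
  assume deg: "degree g \<noteq> 0"
  have "\<not> p dvd lead_coeff h"
    using lead by (auto simp: lead_coeff_mult intro: dvd_mult)
  then have ex: "\<exists>i. \<not> p dvd coeff h i" by blast
  define i where "i = (LEAST i. \<not> p dvd coeff h i)"
  have i: "\<not> p dvd coeff h i"
    unfolding i_def by (rule LeastI_ex[OF ex])
  have less: "p dvd coeff h j" if "j < i" for j
    using not_less_Least[of j "\<lambda>i. \<not> p dvd coeff h i"] that unfolding i_def by blast
  have "g \<noteq> 0" "h \<noteq> 0" using deg i by auto
  moreover have "i \<le> degree h" using i by (metis coeff_eq_0 dvd_0_right not_le)
  ultimately have "i < degree (g * h)" using deg by (simp add: degree_mult_eq)
  then have "p dvd coeff (g * h) i" by (rule dvd)
  also have "coeff (g * h) i = coeff g 0 * coeff h i + (\<Sum>j\<in>{..i} - {0}. coeff g j * coeff h (i - j))"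
    unfolding coeff_mult by (subst sum.remove[of _ 0]) auto
  finally have "p dvd coeff g 0 * coeff h i"
  proof (subst (asm) dvd_add_left_iff)
    show "p dvd (\<Sum>j\<in>{..i} - {0}. coeff g j * coeff h (i - j))"
      by (rule dvd_sum) (auto intro!: dvd_mult less)
  qed
  then show False using i g0 p by (simp add: prime_dvd_mult_iff)
qed

text \<open>The constant term is a product divisible by \<open>p\<close> but not by its square, so
  exactly one factor has constant term divisible by \<open>p\<close>; the other factor is then
  constant.\<close>

lemma eisenstein:
  fixes g h :: "int poly" and p :: int
  assumes p: "prime p"
    and dvd: "\<And>i. i < degree (g * h) \<Longrightarrow> p dvd coeff (g * h) i"
    and lead: "\<not> p dvd lead_coeff (g * h)"
    and sq: "\<not> p\<^sup>2 dvd coeff (g * h) 0"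
  shows "degree g = 0 \<or> degree h = 0"
proof (cases "degree (g * h) = 0")
  case True
  have "g \<noteq> 0" "h \<noteq> 0" using lead by auto
  then show ?thesis using True by (simp add: degree_mult_eq)
next
  case False
  then have "p dvd coeff g 0 * coeff h 0"
    using dvd[of 0] by (simp add: coeff_mult)
  moreover have "\<not> (p dvd coeff g 0 \<and> p dvd coeff h 0)"
    using sq by (auto simp: coeff_mult power2_eq_square intro: mult_dvd_mono)
  ultimately consider "\<not> p dvd coeff g 0" "p dvd coeff h 0" | "\<not> p dvd coeff h 0" "p dvd coeff g 0"
    using p by (auto simp: prime_dvd_mult_iff)
  then show ?thesis
    using eisenstein_aux[of p g h] eisenstein_aux[of p h g] assms by cases (auto simp: mult.commute)
qed

definition cyclo :: "nat \<Rightarrow> int poly" where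
  "cyclo p = (\<Sum>i<p. [:0, 1:] ^ i)"

lemma cyclo_mult: "[:-1, 1:] * cyclo p = [:0, 1:] ^ p - 1"
proof -
  have "[:-1, 1:] = [:0, 1:] - (1 :: int poly)" by (simp add: one_pCons)
  then show ?thesis unfolding cyclo_def by (simp only: power_diff_1_eq)
qed

lemma pcompose_power: "pcompose (q ^ n) r = pcompose q r ^ n"
  by (induction n) (simp_all add: pcompose_mult pcompose_1)

text \<open>Substituting X + 1 into (X - 1) \<open>cyclo p\<close> = X^p - 1 gives X times the
  shifted polynomial = (X + 1)^p - 1; then compare coefficients.\<close>

lemma coeff_cyclo_shift: "coeff (pcompose (cyclo p) [:1, 1:]) i = int (p choose Suc i)"
proof -
  have "pcompose ([:-1, 1:] * cyclo p) [:1, 1:] = pcompose ([:0, 1:] ^ p - 1) [:1, 1::int:]"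
    by (simp only: cyclo_mult)
  then have "[:0, 1:] * pcompose (cyclo p) [:1, 1:] = [:1, 1:] ^ p - 1"
    by (simp add: pcompose_mult pcompose_diff pcompose_power pcompose_pCons pcompose_1)
  then have "coeff ([:0, 1:] * pcompose (cyclo p) [:1, 1:]) (Suc i) = coeff ([:1, 1:] ^ p - 1) (Suc i)"
    by simp
  then show ?thesis
    by (cases "Suc i \<le> p") (auto simp: coeff_linear_poly_power binomial_eq_0 coeff_eq_0 degree_linear_power)
qed

lemma degree_cyclo_shift: "p > 0 \<Longrightarrow> degree (pcompose (cyclo p) [:1, 1:]) = p - 1"
  by (intro antisym degree_le le_degree) (auto simp: coeff_cyclo_shift binomial_eq_0)

lemma degree_cyclo: "p > 0 \<Longrightarrow> degree (cyclo p) = p - 1"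
  using degree_cyclo_shift[of p] by (simp add: degree_pcompose)

text \<open>Eisenstein's criterion applies after the shift: the coefficients are binomials, all
  divisible by \<open>p\<close> except the leading 1, and the constant term is \<open>p\<close>
  itself.\<close>

lemma cyclo_factor:
  assumes p: "prime p" and eq: "cyclo p = g * h"
  shows "degree g = 0 \<or> degree h = 0"
proof -
  let ?s = "\<lambda>q. pcompose q [:1, 1::int:]"
  have eq': "?s (cyclo p) = ?s g * ?s h" by (simp add: eq pcompose_mult)
  have pos: "p > 0" using p by (rule prime_gt_0_nat)
  have "degree (?s g) = 0 \<or> degree (?s h) = 0"
  proof (rule eisenstein[of "int p"])
    show "prime (int p)" using p by simp
    fix i assume "i < degree (?s g * ?s h)"
    then have "Suc i < p" using degree_cyclo_shift[OF pos] by (simp flip: eq')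
    then show "int p dvd coeff (?s g * ?s h) i"
      using dvd_choose_prime[of "Suc i" p] p pos by (simp add: coeff_cyclo_shift flip: eq')
  next
    show "\<not> int p dvd lead_coeff (?s g * ?s h)"
      using degree_cyclo_shift[OF pos] pos p by (auto simp: coeff_cyclo_shift simp flip: eq')
    have "\<not> p\<^sup>2 dvd p"
      using p prime_gt_1_nat[OF p] by (auto simp: power2_eq_square)
    then have "\<not> (int p)\<^sup>2 dvd int p" by (simp flip: of_nat_power)
    moreover have "coeff (?s g * ?s h) 0 = int p"
      using coeff_cyclo_shift[of p 0] by (simp only: eq') simp
    ultimately show "\<not> (int p)\<^sup>2 dvd coeff (?s g * ?s h) 0" by simp
  qed
  then show ?thesis by (simp add: degree_pcompose)
qed

section \<open>Integer polynomials evaluated at roots of unity\<close>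

abbreviation ipoly :: "int poly \<Rightarrow> complex \<Rightarrow> complex" where
  "ipoly h z \<equiv> poly (map_poly of_int h) z"

lemma ipoly_add: "ipoly (f + g) z = ipoly f z + ipoly g z"
proof -
  have "map_poly of_int (f + g) = map_poly of_int f + (map_poly of_int g :: complex poly)"
    by (rule poly_eqI) (simp add: coeff_map_poly)
  then show ?thesis by simp
qed

lemma ipoly_diff: "ipoly (f - g) z = ipoly f z - ipoly g z"
proof -
  have "map_poly of_int (f - g) = map_poly of_int f - (map_poly of_int g :: complex poly)"
    by (rule poly_eqI) (simp add: coeff_map_poly)
  then show ?thesis by simp
qed

lemma ipoly_mult: "ipoly (f * g) z = ipoly f z * ipoly g z"
proof -
  have "map_poly of_int (f * g) = map_poly of_int f * (map_poly of_int g :: complex poly)"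
    by (rule poly_eqI) (simp add: coeff_map_poly coeff_mult)
  then show ?thesis by simp
qed

lemma ipoly_1: "ipoly 1 z = 1" by simp

lemma ipoly_X_power: "ipoly ([:0, 1:] ^ n) z = z ^ n"
  by (induction n) (simp_all add: ipoly_mult map_poly_pCons)

lemma ipoly_cyclo:
  assumes "z ^ p = 1" "z \<noteq> 1"
  shows "ipoly (cyclo p) z = 0"
proof -
  have "ipoly [:-1, 1:] z * ipoly (cyclo p) z = ipoly ([:0, 1:] ^ p - 1) z"
    by (simp only: cyclo_mult flip: ipoly_mult)
  also have "\<dots> = 0" by (simp only: ipoly_diff ipoly_X_power ipoly_1 assms diff_self)
  finally show ?thesis using assms by (simp add: map_poly_pCons)
qed

text \<open>All nontrivial p-th roots of unity have the same minimal polynomial. A primitive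
  \<open>g\<close> of least degree vanishing at \<open>z\<close> divides every integer polynomial
  that vanishes at \<open>z\<close>; in particular it divides \<open>cyclo p\<close>, and
  irreducibility makes the cofactor a constant, in fact a unit.\<close>

lemma ipoly_eq_0_iff_cyclo_dvd:
  assumes p: "prime p" and z: "z ^ p = 1" "z \<noteq> 1"
  shows "ipoly h z = 0 \<longleftrightarrow> cyclo p dvd h"
proof
  assume "cyclo p dvd h"
  then show "ipoly h z = 0" using ipoly_cyclo[OF z] by (auto simp: ipoly_mult elim!: dvdE)
next
  assume h: "ipoly h z = 0"
  have c0: "cyclo p \<noteq> 0"
    using degree_cyclo[OF prime_gt_0_nat[OF p]] prime_gt_1_nat[OF p] by auto
  let ?P = "\<lambda>g. g \<noteq> 0 \<and> ipoly g z = 0"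
  have "?P (cyclo p)" using c0 ipoly_cyclo[OF z] by simp
  then obtain g0 where g0: "?P g0" "\<And>g. ?P g \<Longrightarrow> degree g0 \<le> degree g"
    using ex_has_least_nat[of ?P "cyclo p" degree] by blast
  define g where "g = primitive_part g0"
  have g0': "g0 = smult (content g0) g" by (simp add: g_def)
  have cg: "content g = 1" using g0 by (simp add: g_def)
  have "ipoly g0 z = ipoly ([:content g0:] * g) z" by (simp add: g_def)
  also have "\<dots> = of_int (content g0) * ipoly g z"
    by (simp only: ipoly_mult) (simp add: map_poly_pCons)
  finally have gz: "ipoly g z = 0" using g0 by auto
  have gn0: "g \<noteq> 0" using g0 by (simp add: g_def)
  have deg: "degree g = degree g0" by (simp add: g_def)
  have min: "g dvd f" if f: "ipoly f z = 0" for f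
  proof -
    \<comment> \<open>Over the integers only a multiple \<open>smult a f\<close> can be divided by
      \<open>g\<close> with remainder.\<close>
    define r where "r = pseudo_mod f g"
    obtain a q where aq: "a \<noteq> 0" "smult a f = g * q + r"
      using pseudo_mod(1)[OF gn0, of f] unfolding r_def by blast
    have rdeg: "r = 0 \<or> degree r < degree g"
      using pseudo_mod(2)[OF gn0, of f] unfolding r_def .
    have "ipoly r z = ipoly ([:a:] * f - g * q) z" using aq(2) by simp
    also have "\<dots> = 0" by (simp only: ipoly_diff ipoly_mult f gz mult_zero_right mult_zero_left diff_self)
    finally have "r = 0" using g0(2)[of r] rdeg deg by force
    with aq have eq: "smult a f = g * q" by simp
    \<comment> \<open>Gauss's lemma: contents multiply and \<open>g\<close> is primitive, so
      \<open>a\<close> divides every coefficient of \<open>q\<close> and can be cancelled.\<close>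
    have "content q = content (smult a f)" by (simp add: eq content_mult cg)
    then have "a dvd content q" by simp
    then have "[:a:] dvd q" by (simp only: const_poly_dvd_iff_dvd_content)
    then obtain q' where "q = smult a q'" by (auto elim: dvdE)
    with eq have "smult a f = smult a (g * q')" by simp
    then have "f = g * q'" by (rule smult_cancel[OF aq(1)])
    then show ?thesis by simp
  qed
  obtain k where k: "cyclo p = g * k" using min ipoly_cyclo[OF z] by blast
  have "degree g \<noteq> 0"
  proof
    assume "degree g = 0"
    then obtain c where "g = [:c:]" by (rule degree_eq_zeroE)
    then show False using gz gn0 by (simp add: map_poly_pCons)
  qed
  then have "degree k = 0" using cyclo_factor[OF p k] by simp
  then obtain c where c: "k = [:c:]" by (rule degree_eq_zeroE)
  \<comment> \<open>The leading coefficient 1 of the shifted polynomial is a multiple of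
    \<open>c\<close>, which makes \<open>c\<close> a unit.\<close>
  have "coeff (pcompose (cyclo p) [:1, 1:]) (p - 1) = 1"
    using prime_gt_0_nat[OF p] by (simp add: coeff_cyclo_shift)
  moreover have "pcompose (cyclo p) [:1, 1:] = smult c (pcompose g [:1, 1:])"
    by (simp add: k c pcompose_smult)
  ultimately have "c dvd 1" by (metis coeff_smult dvd_triv_left)
  then have "[:c:] dvd 1" by (simp only: one_pCons const_poly_dvd_const_poly_iff)
  then obtain d where d: "1 = [:c:] * d" by (rule dvdE)
  have "cyclo p * d = g" using k c d by (metis mult.assoc mult.right_neutral)
  then show "cyclo p dvd h" using min[OF h] by (metis dvd_mult_left)
qed

lemma ipoly_sum: "ipoly (sum f I) z = (\<Sum>i\<in>I. ipoly (f i) z)"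
  by (induction I rule: infinite_finite_induct) (simp_all add: ipoly_add)

lemma ipoly_pCons: "ipoly (pCons a h) z = of_int a + z * ipoly h z"
  by (simp add: map_poly_pCons)

text \<open>An inverse of \<open>k\<close> modulo \<open>p\<close>, stated over the naturals so that
  both sides can serve as exponents.\<close>

lemma bezout_not_dvd:
  fixes p k :: nat
  assumes p: "prime p" and k: "\<not> p dvd k"
  obtains x y where "k * x = p * y + 1"
proof -
  have "gcd k p = 1" using p k by (metis coprime_commute coprime_iff_gcd_eq_1 prime_imp_coprime)
  moreover have "k \<noteq> 0" using k by (intro notI) simp
  ultimately show ?thesis using bezout_nat[of k p] that by auto
qed

lemma root_of_unity_power_eq_1_iff:
  fixes z :: complex
  assumes p: "prime p" and z: "z ^ p = 1" "z \<noteq> 1"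
  shows "z ^ k = 1 \<longleftrightarrow> p dvd k"
proof
  assume k: "z ^ k = 1"
  show "p dvd k"
  proof (rule ccontr)
    assume "\<not> p dvd k"
    then obtain x y where "k * x = p * y + 1" by (rule bezout_not_dvd[OF p])
    then have "(z ^ k) ^ x = (z ^ p) ^ y * z" by (simp flip: power_mult)
    then show False using k z by simp
  qed
qed (auto simp: power_mult z elim!: dvdE)

lemma zeta_power_self: "p > 0 \<Longrightarrow> zeta p ^ p = 1"
  unfolding zeta_def by (simp flip: exp_of_nat_mult)

lemma zeta_power: "zeta p ^ j = exp (2 * of_real pi * \<i> * of_nat j / of_nat p)"
  unfolding zeta_def by (simp flip: exp_of_nat_mult add: mult_ac)

lemma zeta_neq_1: "p > 1 \<Longrightarrow> zeta p \<noteq> 1"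
  using complex_root_unity_eq[of p 1 0] zeta_power[of p 1] by simp

lemma root_of_unity_eq_zeta_power:
  assumes "p > 0" "w ^ p = 1"
  obtains k where "k < p" "w = zeta p ^ k"
  using complex_roots_unity[of p] assms zeta_power[of p] by (auto simp: set_eq_iff Suc_le_eq)

section \<open>Automorphisms and traces of the cyclotomic field\<close>

lemma is_subfieldD:
  assumes "is_subfield K"
  shows "1 \<in> K" "0 \<in> K" "x \<in> K \<Longrightarrow> y \<in> K \<Longrightarrow> x - y \<in> K" "x \<in> K \<Longrightarrow> y \<in> K \<Longrightarrow> x + y \<in> K"
    "x \<in> K \<Longrightarrow> y \<in> K \<Longrightarrow> x * y \<in> K" "x \<in> K \<Longrightarrow> inverse x \<in> K"
proof -
  show 1: "1 \<in> K" and diff: "\<And>x y. x \<in> K \<Longrightarrow> y \<in> K \<Longrightarrow> x - y \<in> K"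
    and "x \<in> K \<Longrightarrow> y \<in> K \<Longrightarrow> x * y \<in> K" "x \<in> K \<Longrightarrow> inverse x \<in> K"
    using assms unfolding is_subfield_def by blast+
  show 0: "0 \<in> K" using diff[OF 1 1] by simp
  show "x + y \<in> K" if "x \<in> K" "y \<in> K"
    using diff[OF \<open>x \<in> K\<close> diff[OF 0 \<open>y \<in> K\<close>]] by simp
qed

lemma is_subfield_of_int:
  assumes K: "is_subfield K"
  shows "of_int n \<in> K"
proof (cases n rule: int_cases2)
  have nat: "of_nat m \<in> K" for m
    by (induction m) (auto intro: is_subfieldD[OF K])
  case (nonneg m)
  then show ?thesis using nat by simp
next
  have nat: "of_nat m \<in> K" for m
    by (induction m) (auto intro: is_subfieldD[OF K])
  case (nonpos m)
  then show ?thesis using is_subfieldD(3)[OF K is_subfieldD(2)[OF K] nat[of m]] by simp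
qed

lemma is_subfield_ipoly:
  assumes K: "is_subfield K" and "z \<in> K"
  shows "ipoly h z \<in> K"
  by (induction h) (auto simp: ipoly_pCons intro!: is_subfieldD[OF K] is_subfield_of_int[OF K] assms)

lemma is_subfield_cyclotomic: "is_subfield (cyclotomic_field p)"
  unfolding cyclotomic_field_def by (rule hull_in) (auto simp: is_subfield_def)

lemma zeta_in_cyclotomic: "zeta p \<in> cyclotomic_field p"
  unfolding cyclotomic_field_def by (simp add: hull_inc)

text \<open>The quotients form a subfield containing \<open>zeta p\<close>, and every such subfield
  contains them. Working with quotients makes closure under inverses immediate.\<close>

lemma cyclotomic_field_eq:
  "cyclotomic_field p = {ipoly f (zeta p) / ipoly g (zeta p) | f g. ipoly g (zeta p) \<noteq> 0}" (is "_ = ?Q")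
proof
  let ?z = "zeta p"
  have QI: "x \<in> ?Q" if "x = ipoly f ?z / ipoly g ?z" "ipoly g ?z \<noteq> 0" for x f g
    using that by blast
  have "is_subfield ?Q"
    unfolding is_subfield_def
  proof (intro conjI ballI)
    show "1 \<in> ?Q" by (rule QI[of _ 1 1]) simp_all
  next
    fix x y assume "x \<in> ?Q" "y \<in> ?Q"
    then obtain f g f' g' where x: "x = ipoly f ?z / ipoly g ?z" "ipoly g ?z \<noteq> 0"
      and y: "y = ipoly f' ?z / ipoly g' ?z" "ipoly g' ?z \<noteq> 0" by blast
    show "x - y \<in> ?Q"
      by (rule QI[of _ "f * g' - f' * g" "g * g'"])
        (use x y in \<open>simp_all add: ipoly_mult ipoly_diff diff_frac_eq\<close>)
    show "x * y \<in> ?Q"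
      by (rule QI[of _ "f * f'" "g * g'"]) (use x y in \<open>simp_all add: ipoly_mult\<close>)
  next
    fix x assume "x \<in> ?Q"
    then obtain f g where x: "x = ipoly f ?z / ipoly g ?z" "ipoly g ?z \<noteq> 0" by blast
    show "inverse x \<in> ?Q"
    proof (cases "ipoly f ?z = 0")
      \<comment> \<open>Here \<open>inverse 0 = 0\<close>, so swapping numerator and denominator
        fails and 0/1 is used.\<close>
      case True
      then show ?thesis using x by (intro QI[of _ 0 1]) simp_all
    next
      case False
      then show ?thesis using x by (intro QI[of _ g f]) simp_all
    qed
  qed
  moreover have "?z \<in> ?Q"
    by (rule QI[of _ "[:0, 1:]" 1]) (simp_all add: ipoly_pCons)
  ultimately show "cyclotomic_field p \<subseteq> ?Q"
    unfolding cyclotomic_field_def by (intro hull_minimal) auto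
  have "ipoly f ?z / ipoly g ?z \<in> cyclotomic_field p" for f g
    unfolding divide_inverse
    by (intro is_subfieldD[OF is_subfield_cyclotomic] is_subfield_ipoly is_subfield_cyclotomic
        zeta_in_cyclotomic)
  then show "?Q \<subseteq> cyclotomic_field p" by blast
qed

lemma Gal_QD:
  assumes "\<sigma> \<in> Gal_Q K"
  shows "x \<in> K \<Longrightarrow> y \<in> K \<Longrightarrow> \<sigma> (x + y) = \<sigma> x + \<sigma> y" "x \<in> K \<Longrightarrow> y \<in> K \<Longrightarrow> \<sigma> (x * y) = \<sigma> x * \<sigma> y"
    "\<sigma> (of_int n) = of_int n" "inj_on \<sigma> K" "\<sigma> \<in> extensional K"
proof -
  show "\<sigma> (of_int n) = of_int n"
    using assms unfolding Gal_Q_def by (metis (mono_tags, lifting) mem_Collect_eq of_rat_of_int_eq)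
qed (use assms in \<open>auto simp: Gal_Q_def bij_betw_def\<close>)

lemma Gal_Q_ipoly:
  assumes K: "is_subfield K" and \<sigma>: "\<sigma> \<in> Gal_Q K" and z: "z \<in> K"
  shows "\<sigma> (ipoly h z) = ipoly h (\<sigma> z)"
proof (induction h)
  case 0
  show ?case using Gal_QD(3)[OF \<sigma>, of 0] by simp
next
  case (pCons a h)
  have "ipoly h z \<in> K" by (rule is_subfield_ipoly[OF K z])
  then have "\<sigma> (of_int a + z * ipoly h z) = of_int a + \<sigma> z * \<sigma> (ipoly h z)"
    using z by (simp add: Gal_QD[OF \<sigma>] is_subfield_of_int[OF K] is_subfieldD[OF K])
  then show ?case by (simp add: ipoly_pCons pCons.IH)
qed

text \<open>An automorphism acts on a quotient of polynomials in \<open>zeta p\<close> by replacing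
  \<open>zeta p\<close> with its image; extensionality turns agreement on the field into equality of
  functions.\<close>

lemma Gal_Q_cyclotomic_eqI:
  assumes \<sigma>: "\<sigma> \<in> Gal_Q (cyclotomic_field p)" and \<tau>: "\<tau> \<in> Gal_Q (cyclotomic_field p)"
    and eq: "\<sigma> (zeta p) = \<tau> (zeta p)"
  shows "\<sigma> = \<tau>"
proof (rule extensionalityI[OF Gal_QD(5)[OF \<sigma>] Gal_QD(5)[OF \<tau>]])
  let ?K = "cyclotomic_field p"
  note K = is_subfield_cyclotomic[of p]
  fix x assume x: "x \<in> ?K"
  then obtain f g where fg: "x = ipoly f (zeta p) / ipoly g (zeta p)" "ipoly g (zeta p) \<noteq> 0"
    by (auto simp: cyclotomic_field_eq)
  have in_K: "ipoly h (zeta p) \<in> ?K" for h by (rule is_subfield_ipoly[OF K zeta_in_cyclotomic])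
  have mult: "\<rho> x * ipoly g (\<rho> (zeta p)) = ipoly f (\<rho> (zeta p)) \<and> ipoly g (\<rho> (zeta p)) \<noteq> 0"
    if \<rho>: "\<rho> \<in> Gal_Q ?K" for \<rho>
  proof
    have "\<rho> (x * ipoly g (zeta p)) = \<rho> (ipoly f (zeta p))" using fg by simp
    then show "\<rho> x * ipoly g (\<rho> (zeta p)) = ipoly f (\<rho> (zeta p))"
      using Gal_QD(2)[OF \<rho> x in_K] Gal_Q_ipoly[OF K \<rho> zeta_in_cyclotomic] by simp
    have "\<rho> (ipoly g (zeta p)) \<noteq> \<rho> (of_int 0)"
      using fg(2) inj_onD[OF Gal_QD(4)[OF \<rho>] _ in_K is_subfield_of_int[OF K]] by fastforce
    then show "ipoly g (\<rho> (zeta p)) \<noteq> 0"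
      using Gal_Q_ipoly[OF K \<rho> zeta_in_cyclotomic] Gal_QD(3)[OF \<rho>, of 0] by simp
  qed
  show "\<sigma> x = \<tau> x"
    using mult[OF \<sigma>] mult[OF \<tau>] eq by (metis mult_right_cancel)
qed

text \<open>The equation \<open>zeta p ^ p = 1\<close> is preserved, and injectivity keeps the image
  different from 1.\<close>

lemma Gal_Q_zeta:
  assumes p: "prime p" and \<sigma>: "\<sigma> \<in> Gal_Q (cyclotomic_field p)"
  shows "\<sigma> (zeta p) \<in> (\<lambda>k. zeta p ^ k) ` {1..p-1}"
proof -
  let ?K = "cyclotomic_field p"
  note K = is_subfield_cyclotomic[of p] and z = zeta_in_cyclotomic[of p]
  have p0: "p > 1" using prime_gt_1_nat[OF p] .
  have "\<sigma> (ipoly ([:0, 1:] ^ p) (zeta p)) = \<sigma> (of_int 1)"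
    using p0 by (simp add: ipoly_X_power zeta_power_self)
  then have "\<sigma> (zeta p) ^ p = 1"
    using Gal_Q_ipoly[OF K \<sigma> z, of "[:0, 1:] ^ p"] Gal_QD(3)[OF \<sigma>, of 1]
    by (simp only: ipoly_X_power of_int_1)
  moreover have "\<sigma> (zeta p) \<noteq> \<sigma> (of_int 1)"
    using inj_onD[OF Gal_QD(4)[OF \<sigma>] _ z is_subfield_of_int[OF K, of 1]] zeta_neq_1[OF p0] by auto
  then have "\<sigma> (zeta p) \<noteq> 1" using Gal_QD(3)[OF \<sigma>, of 1] by simp
  ultimately obtain k where k: "k < p" "\<sigma> (zeta p) = zeta p ^ k" "k \<noteq> 0"
    using root_of_unity_eq_zeta_power[of p "\<sigma> (zeta p)"] p0 by (metis gr_implies_not0 neq0_conv power_0)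
  then have "k \<in> {1..p-1}" by auto
  then show ?thesis using k(2) by blast
qed

text \<open>Quotients of integer polynomials in \<open>\<zeta>\<close> represent the elements of the field; a relation between
  them holds at \<open>\<zeta>\<close> iff it holds at \<open>\<zeta>\<^sup>k\<close>, as both say that the cyclotomic polynomial divides.\<close>

lemma Gal_Q_exists:
  assumes p: "prime p" and k: "\<not> p dvd k"
  shows "\<exists>\<sigma>\<in>Gal_Q (cyclotomic_field p). \<sigma> (zeta p) = zeta p ^ k"
proof -
  let ?K = "cyclotomic_field p" and ?z = "zeta p"
  define w where "w = zeta p ^ k"
  have p1: "p > 1" using prime_gt_1_nat[OF p] .
  have z: "?z ^ p = 1" "?z \<noteq> 1" using p1 by (simp_all add: zeta_power_self zeta_neq_1)
  have "w ^ p = (?z ^ p) ^ k" unfolding w_def by (simp add: mult.commute flip: power_mult)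
  then have w: "w ^ p = 1" "w \<noteq> 1"
    using z k root_of_unity_power_eq_1_iff[OF p z, of k] by (simp_all add: w_def)
  have iff: "ipoly h w = 0 \<longleftrightarrow> ipoly h ?z = 0" for h
    using ipoly_eq_0_iff_cyclo_dvd[OF p] z w by blast
  define \<sigma> where "\<sigma> = (\<lambda>x\<in>?K. THE y. \<exists>f g. ipoly g ?z \<noteq> 0 \<and> x = ipoly f ?z / ipoly g ?z
    \<and> y = ipoly f w / ipoly g w)"
  have in_K: "ipoly f ?z / ipoly g ?z \<in> ?K" if "ipoly g ?z \<noteq> 0" for f g
    unfolding cyclotomic_field_eq using that by blast
  have \<sigma>: "\<sigma> (ipoly f ?z / ipoly g ?z) = ipoly f w / ipoly g w" if g: "ipoly g ?z \<noteq> 0" for f g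
  proof -
    have "ipoly f' w / ipoly g' w = ipoly f w / ipoly g w"
      if g': "ipoly g' ?z \<noteq> 0" and eq: "ipoly f ?z / ipoly g ?z = ipoly f' ?z / ipoly g' ?z" for f' g'
    proof -
      have "ipoly (f * g' - f' * g) ?z = 0"
        using eq g g' by (simp add: ipoly_diff ipoly_mult frac_eq_eq)
      then have "ipoly (f * g' - f' * g) w = 0" using iff by blast
      then show ?thesis
        using iff g g' by (simp add: ipoly_diff ipoly_mult frac_eq_eq)
    qed
    then have "(THE y. \<exists>f' g'. ipoly g' ?z \<noteq> 0 \<and> ipoly f ?z / ipoly g ?z = ipoly f' ?z / ipoly g' ?z
        \<and> y = ipoly f' w / ipoly g' w) = ipoly f w / ipoly g w"
      using g by (intro the_equality) blast+
    then show ?thesis unfolding \<sigma>_def using in_K[OF g] by simp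
  qed
  have K: "\<exists>f g. x = ipoly f ?z / ipoly g ?z \<and> ipoly g ?z \<noteq> 0 \<and> \<sigma> x = ipoly f w / ipoly g w \<and> ipoly g w \<noteq> 0"
    if "x \<in> ?K" for x
    using that \<sigma> iff unfolding cyclotomic_field_eq by blast
  have hom: "\<sigma> (x + y) = \<sigma> x + \<sigma> y \<and> \<sigma> (x * y) = \<sigma> x * \<sigma> y" if xy: "x \<in> ?K" "y \<in> ?K" for x y
  proof -
    obtain f g f' g' where *: "x = ipoly f ?z / ipoly g ?z" "ipoly g ?z \<noteq> 0" "\<sigma> x = ipoly f w / ipoly g w"
       "ipoly g w \<noteq> 0" "y = ipoly f' ?z / ipoly g' ?z" "ipoly g' ?z \<noteq> 0" "\<sigma> y = ipoly f' w / ipoly g' w"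
       "ipoly g' w \<noteq> 0"
      using K[OF xy(1)] K[OF xy(2)] by blast
    have "x + y = ipoly (f * g' + f' * g) ?z / ipoly (g * g') ?z"
      "x * y = ipoly (f * f') ?z / ipoly (g * g') ?z"
      using * by (simp_all add: ipoly_add ipoly_mult add_frac_eq)
    moreover have "ipoly (g * g') ?z \<noteq> 0" using * by (simp add: ipoly_mult)
    ultimately have "\<sigma> (x + y) = ipoly (f * g' + f' * g) w / ipoly (g * g') w"
      "\<sigma> (x * y) = ipoly (f * f') w / ipoly (g * g') w"
      using \<sigma> by auto
    then show ?thesis using * by (simp_all add: ipoly_add ipoly_mult add_frac_eq)
  qed
  have rat: "\<sigma> (of_rat q) = of_rat q" for q :: rat
  proof -
    obtain a b where "b > 0" and q: "q = Fract a b" by (cases q)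
    then have "of_rat q = (of_int a / of_int b :: complex)" by (simp add: of_rat_rat)
    then have "of_rat q = ipoly [:a:] v / ipoly [:b:] v" for v by (simp add: ipoly_pCons)
    then show ?thesis using \<sigma>[of "[:b:]" "[:a:]"] \<open>b > 0\<close> by (simp add: ipoly_pCons)
  qed
  have inj: "inj_on \<sigma> ?K"
  proof (rule inj_onI)
    fix x y assume xy: "x \<in> ?K" "y \<in> ?K" and eq: "\<sigma> x = \<sigma> y"
    obtain f g f' g' where *: "x = ipoly f ?z / ipoly g ?z" "ipoly g ?z \<noteq> 0" "\<sigma> x = ipoly f w / ipoly g w"
       "ipoly g w \<noteq> 0" "y = ipoly f' ?z / ipoly g' ?z" "ipoly g' ?z \<noteq> 0" "\<sigma> y = ipoly f' w / ipoly g' w"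
       "ipoly g' w \<noteq> 0"
      using K[OF xy(1)] K[OF xy(2)] by blast
    then have "ipoly (f * g' - f' * g) w = 0"
      using eq by (simp add: ipoly_diff ipoly_mult frac_eq_eq)
    then have "ipoly (f * g' - f' * g) ?z = 0" using iff by blast
    then show "x = y" using * by (simp add: ipoly_diff ipoly_mult frac_eq_eq)
  qed
  \<comment> \<open>Inverting \<open>k\<close> modulo \<open>p\<close> expresses
    \<open>zeta p\<close> as a power of \<open>w\<close>, which will give surjectivity.\<close>
  have "\<exists>l. ?z = w ^ l"
  proof -
    obtain x y where "k * x = p * y + 1" using bezout_not_dvd[OF p k] .
    then have "w ^ x = (?z ^ p) ^ y * ?z" unfolding w_def by (simp flip: power_mult)
    then show ?thesis using z by (intro exI[of _ x]) simp
  qed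
  then obtain l where l: "?z = w ^ l" ..
  have X: "ipoly (pcompose h ([:0, 1:] ^ l)) v = ipoly h (v ^ l)" for h v
    by (induction h) (simp_all add: pcompose_pCons ipoly_add ipoly_mult ipoly_pCons ipoly_X_power)
  have "\<sigma> ` ?K = ?K"
  proof (intro equalityI subsetI)
    fix y assume "y \<in> \<sigma> ` ?K"
    then obtain x where x: "x \<in> ?K" and y: "y = \<sigma> x" by blast
    obtain f g where *: "y = ipoly f w / ipoly g w"
      using K[OF x] y by blast
    have "w \<in> ?K"
      unfolding w_def using is_subfield_ipoly[OF is_subfield_cyclotomic zeta_in_cyclotomic, of "[:0, 1:] ^ k" p]
      by (simp add: ipoly_X_power)
    then show "y \<in> ?K"
      unfolding * divide_inverse
      by (intro is_subfieldD[OF is_subfield_cyclotomic] is_subfield_ipoly is_subfield_cyclotomic)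
  next
    fix y assume "y \<in> ?K"
    then obtain f g where y: "y = ipoly f ?z / ipoly g ?z" and g: "ipoly g ?z \<noteq> 0"
      unfolding cyclotomic_field_eq by blast
    \<comment> \<open>Substituting X^l for X turns evaluation at \<open>w\<close> into evaluation at
      \<open>zeta p\<close>, so the quotient of \<open>?c f\<close> and \<open>?c g\<close> at
      \<open>zeta p\<close> is a preimage of \<open>y\<close>.\<close>
    let ?c = "\<lambda>h. pcompose h ([:0, 1:] ^ l)"
    have g': "ipoly (?c g) ?z \<noteq> 0"
      using g iff[of "?c g"] unfolding X by (simp flip: l)
    have "\<sigma> (ipoly (?c f) ?z / ipoly (?c g) ?z) = ipoly (?c f) w / ipoly (?c g) w"
      by (rule \<sigma>[OF g'])
    also have "\<dots> = y" by (simp only: X y flip: l)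
    finally show "y \<in> \<sigma> ` ?K" using in_K[OF g'] by (metis imageI)
  qed
  then have "bij_betw \<sigma> ?K ?K" using inj by (simp add: bij_betw_def)
  then have "\<sigma> \<in> Gal_Q ?K"
    unfolding Gal_Q_def using hom rat by (auto simp: \<sigma>_def)
  moreover have "\<sigma> ?z = w"
    using \<sigma>[of 1 "[:0, 1:]"] by (simp add: ipoly_pCons)
  ultimately show ?thesis unfolding w_def by blast
qed

lemma zeta_power_inj:
  assumes p: "prime p"
  shows "inj_on (\<lambda>k. zeta p ^ k) {..<p}"
proof (rule linorder_inj_onI')
  fix i j assume "i \<in> {..<p}" "j \<in> {..<p}" "i < j"
  have p1: "p > 1" using prime_gt_1_nat[OF p] .
  have z0: "zeta p \<noteq> 0" by (simp add: zeta_def)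
  have "\<not> p dvd j - i" using \<open>i < j\<close> \<open>j \<in> {..<p}\<close> by (auto dest: dvd_imp_le)
  then have "zeta p ^ (j - i) \<noteq> 1"
    using root_of_unity_power_eq_1_iff[OF p zeta_power_self zeta_neq_1] p1 by auto
  moreover have "zeta p ^ j = zeta p ^ i * zeta p ^ (j - i)"
    using \<open>i < j\<close> by (simp flip: power_add)
  ultimately show "zeta p ^ i \<noteq> zeta p ^ j" using z0 by auto
qed

text \<open>Evaluation at \<open>zeta p\<close> is a bijection from the Galois group onto the
  nontrivial p-th roots of unity, so the trace becomes an explicit sum.\<close>

lemma Tr_ipoly:
  assumes p: "prime p"
  shows "Tr p (ipoly h (zeta p)) = (\<Sum>k=1..p-1. ipoly h (zeta p ^ k))"
proof -
  let ?G = "Gal_Q (cyclotomic_field p)"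
  have "inj_on (\<lambda>\<sigma>. \<sigma> (zeta p)) ?G"
    by (rule inj_onI) (rule Gal_Q_cyclotomic_eqI)
  moreover have "(\<lambda>\<sigma>. \<sigma> (zeta p)) ` ?G = (\<lambda>k. zeta p ^ k) ` {1..p-1}"
  proof (intro equalityI image_subsetI)
    fix k assume "k \<in> {1..p-1}"
    then have "\<not> p dvd k" by (auto dest: dvd_imp_le)
    from Gal_Q_exists[OF p this] show "zeta p ^ k \<in> (\<lambda>\<sigma>. \<sigma> (zeta p)) ` ?G"
      by (metis (mono_tags, lifting) imageI)
  qed (rule Gal_Q_zeta[OF p])
  ultimately have bij: "bij_betw (\<lambda>\<sigma>. \<sigma> (zeta p)) ?G ((\<lambda>k. zeta p ^ k) ` {1..p-1})"
    by (simp add: bij_betw_def)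
  have "Tr p (ipoly h (zeta p)) = (\<Sum>\<sigma>\<in>?G. ipoly h (\<sigma> (zeta p)))"
    unfolding Tr_def
    by (intro sum.cong refl Gal_Q_ipoly[OF is_subfield_cyclotomic _ zeta_in_cyclotomic])
  also have "\<dots> = (\<Sum>w\<in>(\<lambda>k. zeta p ^ k) ` {1..p-1}. ipoly h w)"
    using sum.reindex_bij_betw[OF bij] .
  also have "\<dots> = (\<Sum>k=1..p-1. ipoly h (zeta p ^ k))"
  proof (subst sum.reindex)
    have "{1..p-1} \<subseteq> {..<p}" using prime_gt_0_nat[OF p] by auto
    then show "inj_on (\<lambda>k. zeta p ^ k) {1..p-1}" by (rule inj_on_subset[OF zeta_power_inj[OF p]])
  qed simp
  finally show ?thesis .
qed

text \<open>The trace of \<open>zeta p ^ m\<close>: the geometric sum over all \<open>k < p\<close>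
  is \<open>p\<close> or 0, and the term \<open>k = 0\<close> is removed.\<close>

lemma sum_zeta_powers:
  assumes p: "prime p"
  shows "(\<Sum>k=1..p-1. (zeta p ^ k) ^ m) = (if p dvd m then of_nat p - 1 else -1)"
proof -
  have p1: "p > 1" using prime_gt_1_nat[OF p] .
  define w where "w = zeta p ^ m"
  have w: "w = 1 \<longleftrightarrow> p dvd m"
    unfolding w_def using root_of_unity_power_eq_1_iff[OF p zeta_power_self zeta_neq_1] p1 by auto
  have "w ^ p = (zeta p ^ p) ^ m" unfolding w_def by (simp add: mult.commute flip: power_mult)
  then have wp: "w ^ p = 1" using zeta_power_self[of p] p1 by simp
  have "(\<Sum>k=1..p-1. (zeta p ^ k) ^ m) = (\<Sum>k=1..p-1. w ^ k)"
    unfolding w_def by (simp add: mult.commute flip: power_mult)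
  also have "\<dots> = (\<Sum>k<p. w ^ k) - 1"
  proof -
    have "{..<p} = insert 0 {1..p-1}" using p1 by auto
    then show ?thesis by simp
  qed
  also have "\<dots> = (if p dvd m then of_nat p - 1 else -1)"
  proof (cases "p dvd m")
    case False
    then have "(\<Sum>k<p. w ^ k) = 0" using w wp power_diff_1_eq[of w p] by simp
    with False show ?thesis by simp
  qed (use w in simp)
  finally show ?thesis .
qed

section \<open>Coordinates of field elements under the trace embedding\<close>

definition cyc_sum :: "nat \<Rightarrow> (nat \<Rightarrow> int) \<Rightarrow> complex" where
  "cyc_sum p a = (\<Sum>j=1..p-1. of_int (a j) * zeta p ^ j)"

text \<open>These are the coordinates of \<^term>\<open>psi p\<close> in reverse order, which makes the \<open>j\<close>-th one depend on \<^term>\<open>a j\<close>.\<close>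

definition ctrace :: "nat \<Rightarrow> (nat \<Rightarrow> int) \<Rightarrow> nat \<Rightarrow> int" where
  "ctrace p a j = int p * a j - (\<Sum>i=1..p-1. a i)"

text \<open>As \<open>0 < j + m < 2 * p\<close>, the trace of \<open>zeta p ^ (j + m)\<close> is
  \<open>p - 1\<close> for \<open>j = p - m\<close> and -1 for every other \<open>j\<close>.\<close>

lemma psi_cyc_sum:
  assumes p: "prime p" and m: "m \<in> {1..p-1}"
  shows "psi p (cyc_sum p a) m = of_int (ctrace p a (p - m))"
proof -
  let ?h = "\<Sum>j=1..p-1. [:a j:] * [:0, 1:] ^ (j + m)"
  have h: "ipoly ?h v = (\<Sum>j=1..p-1. of_int (a j) * v ^ (j + m))" for v
    by (simp only: ipoly_sum ipoly_mult ipoly_X_power) (simp add: ipoly_pCons)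
  have dvd: "p dvd j + m \<longleftrightarrow> j = p - m" if "j \<in> {1..p-1}" for j
  proof
    assume "p dvd j + m"
    then obtain c where c: "j + m = p * c" by (rule dvdE)
    have "0 < j + m" "j + m < p * 2" using that m by auto
    then have "0 < c" "c < 2" unfolding c by simp_all
    then have "c = 1" by simp
    then show "j = p - m" using c by simp
  qed (use m in auto)
  have "psi p (cyc_sum p a) m = Tr p (ipoly ?h (zeta p))"
    unfolding psi_def h by (simp add: cyc_sum_def sum_distrib_right power_add mult.assoc)
  also have "\<dots> = (\<Sum>k=1..p-1. \<Sum>j=1..p-1. of_int (a j) * (zeta p ^ k) ^ (j + m))"
    using Tr_ipoly[OF p, of ?h] by (simp only: h)
  also have "\<dots> = (\<Sum>j=1..p-1. of_int (a j) * (\<Sum>k=1..p-1. (zeta p ^ k) ^ (j + m)))"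
    unfolding sum_distrib_left by (rule sum.swap)
  also have "\<dots> = (\<Sum>j=1..p-1. (if j = p - m then of_nat p * of_int (a j) else 0) - of_int (a j))"
    unfolding sum_zeta_powers[OF p] by (intro sum.cong refl) (simp add: dvd algebra_simps)
  also have "\<dots> = of_nat p * of_int (a (p - m)) - (\<Sum>j=1..p-1. of_int (a j))"
    unfolding sum_subtractf using m by (subst sum.delta) auto
  finally show ?thesis by (simp add: ctrace_def)
qed

lemma norm_cyc_sum:
  assumes p: "prime p"
  shows "norm_cyc p (cyc_sum p a) = sqrt (\<Sum>j=1..p-1. (real_of_int (ctrace p a j))\<^sup>2)"
proof -
  have "(\<Sum>m=1..p-1. (cmod (psi p (cyc_sum p a) m))\<^sup>2) = (\<Sum>m=1..p-1. (real_of_int (ctrace p a (p - m)))\<^sup>2)"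
    by (intro sum.cong refl) (simp add: psi_cyc_sum[OF p])
  also have "\<dots> = (\<Sum>j=1..p-1. (real_of_int (ctrace p a j))\<^sup>2)"
    by (rule sum.reindex_bij_witness[of _ "\<lambda>j. p - j" "\<lambda>j. p - j"]) auto
  finally show ?thesis unfolding norm_cyc_def L2_set_def by simp
qed

lemma ctrace_diff: "ctrace p (\<lambda>j. a j - b j) j = ctrace p a j - ctrace p b j"
  by (simp add: ctrace_def sum_subtractf algebra_simps)

lemma cyc_sum_diff: "cyc_sum p (\<lambda>j. a j - b j) = cyc_sum p a - cyc_sum p b"
  by (simp add: cyc_sum_def sum_subtractf algebra_simps)

lemma sum_ctrace:
  assumes "p > 0"
  shows "(\<Sum>j=1..p-1. ctrace p a j) = (\<Sum>j=1..p-1. a j)"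
  using assms by (simp add: ctrace_def sum_subtractf of_nat_diff algebra_simps flip: sum_distrib_left)

text \<open>Linear independence of the powers of \<open>zeta p\<close>: \<open>psi\<close>
  determines all \<open>ctrace p a j\<close>, their sum recovers the sum of the coefficients, and
  then each coefficient follows.\<close>

lemma cyc_sum_eqD:
  assumes p: "prime p" and eq: "cyc_sum p a = cyc_sum p b" and j: "j \<in> {1..p-1}"
  shows "a j = b j"
proof -
  have pos: "p > 0" using p by (rule prime_gt_0_nat)
  have c: "ctrace p a i = ctrace p b i" if i: "i \<in> {1..p-1}" for i
  proof -
    have "p - i \<in> {1..p-1}" "p - (p - i) = i" using i by auto
    then show ?thesis
      using psi_cyc_sum[OF p, of "p - i" a] psi_cyc_sum[OF p, of "p - i" b] eq by simp
  qed
  then have "(\<Sum>j=1..p-1. ctrace p a j) = (\<Sum>j=1..p-1. ctrace p b j)" by (intro sum.cong) auto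
  then show ?thesis using c[OF j] pos unfolding sum_ctrace[OF pos] by (simp add: ctrace_def)
qed

section \<open>Second moments over random signs\<close>

text \<open>The offset \<open>t\<close> carries the induction: splitting off one sign replaces
  \<open>t\<close> by \<open>t + c x * N\<close> and \<open>t - c x * N\<close>, and the cross terms
  cancel in the sum of the two squares.\<close>

lemma sum_PiE_signs_square:
  fixes c :: "'a \<Rightarrow> real" and t :: real and N :: int
  assumes "finite I" "N \<noteq> 0"
  shows "(\<Sum>b\<in>I \<rightarrow>\<^sub>E {-N, N}. (t + (\<Sum>i\<in>I. c i * of_int (b i)))\<^sup>2) = 2 ^ card I * (t\<^sup>2 + (of_int N)\<^sup>2 * (\<Sum>i\<in>I. (c i)\<^sup>2))"
  using assms(1)
proof (induction I arbitrary: t rule: finite_induct)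
  case empty
  then show ?case by simp
next
  case (insert x I)
  have inj: "inj_on (\<lambda>(y, g). g(x := y)) ({-N, N} \<times> (I \<rightarrow>\<^sub>E {-N, N}))"
    using insert.hyps(2) by (rule inj_combinator)
  have *: "(\<Sum>i\<in>I. c i * of_int (if i = x then y else g i)) = (\<Sum>i\<in>I. c i * of_int (g i))" for y and g :: "'a \<Rightarrow> int"
    using insert.hyps(2) by (intro sum.cong) auto
  have "(\<Sum>b\<in>insert x I \<rightarrow>\<^sub>E {-N, N}. (t + (\<Sum>i\<in>insert x I. c i * of_int (b i)))\<^sup>2)
      = (\<Sum>(y, g)\<in>{-N, N} \<times> (I \<rightarrow>\<^sub>E {-N, N}). (t + (\<Sum>i\<in>insert x I. c i * of_int ((g(x := y)) i)))\<^sup>2)"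
    unfolding PiE_insert_eq sum.reindex[OF inj] by (simp add: case_prod_unfold)
  also have "\<dots> = (\<Sum>(y, g)\<in>{-N, N} \<times> (I \<rightarrow>\<^sub>E {-N, N}). ((t + c x * of_int y) + (\<Sum>i\<in>I. c i * of_int (g i)))\<^sup>2)"
    using insert.hyps by (intro sum.cong refl) (auto simp: * add.assoc)
  also have "\<dots> = (\<Sum>y\<in>{-N, N}. \<Sum>g\<in>I \<rightarrow>\<^sub>E {-N, N}. ((t + c x * of_int y) + (\<Sum>i\<in>I. c i * of_int (g i)))\<^sup>2)"
    by (rule sum.cartesian_product[symmetric])
  also have "\<dots> = (\<Sum>y\<in>{-N, N}. 2 ^ card I * ((t + c x * of_int y)\<^sup>2 + (of_int N)\<^sup>2 * (\<Sum>i\<in>I. (c i)\<^sup>2)))"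
    by (simp only: insert.IH)
  also have "\<dots> = 2 ^ card (insert x I) * (t\<^sup>2 + (of_int N)\<^sup>2 * (\<Sum>i\<in>insert x I. (c i)\<^sup>2))"
    using insert.hyps \<open>N \<noteq> 0\<close> by (simp add: power2_eq_square algebra_simps)
  finally show ?case .
qed

text \<open>Markov's inequality for the squared linear form, with the second moment just computed;
  \<open>2 ^ card I\<close> is the number of sign vectors.\<close>

lemma card_PiE_signs_large:
  fixes c :: "'a \<Rightarrow> real" and N :: int and T :: real
  assumes "finite I" "N \<noteq> 0" "T > 0"
  shows "real (card {b \<in> I \<rightarrow>\<^sub>E {-N, N}. (\<Sum>i\<in>I. c i * of_int (b i))\<^sup>2 > T})
    \<le> 2 ^ card I * ((of_int N)\<^sup>2 * (\<Sum>i\<in>I. (c i)\<^sup>2) / T)"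
proof -
  let ?X = "\<lambda>b. (\<Sum>i\<in>I. c i * of_int (b i))\<^sup>2"
  have fin: "finite (I \<rightarrow>\<^sub>E {-N, N})" using assms by (intro finite_PiE) auto
  have "T * real (card {b \<in> I \<rightarrow>\<^sub>E {-N, N}. ?X b > T}) = (\<Sum>b | b \<in> (I \<rightarrow>\<^sub>E {-N, N}) \<and> ?X b > T. T)"
    by simp
  also have "\<dots> \<le> (\<Sum>b | b \<in> (I \<rightarrow>\<^sub>E {-N, N}) \<and> ?X b > T. ?X b)"
    by (rule sum_mono) simp
  also have "\<dots> \<le> (\<Sum>b\<in>I \<rightarrow>\<^sub>E {-N, N}. ?X b)"
    by (rule sum_mono2[OF fin]) auto
  also have "\<dots> = 2 ^ card I * ((of_int N)\<^sup>2 * (\<Sum>i\<in>I. (c i)\<^sup>2))"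
    using sum_PiE_signs_square[OF assms(1,2), of 0 c] by simp
  finally show ?thesis using assms by (simp add: field_simps)
qed


section \<open>Vertices, inner products and angles in coordinates\<close>

lemma cyc_vertices_eq: "cyc_vertices p N = cyc_sum p ` ({1..p-1} \<rightarrow>\<^sub>E {- int N, int N})"
proof
  show "cyc_sum p ` ({1..p-1} \<rightarrow>\<^sub>E {- int N, int N}) \<subseteq> cyc_vertices p N"
    unfolding cyc_vertices_def cyc_sum_def by (auto simp: PiE_iff)
  show "cyc_vertices p N \<subseteq> cyc_sum p ` ({1..p-1} \<rightarrow>\<^sub>E {- int N, int N})"
  proof
    fix x assume "x \<in> cyc_vertices p N"
    then obtain a where x: "x = cyc_sum p a" and a: "\<forall>j\<in>{1..p-1}. a j \<in> {- int N, int N}"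
      unfolding cyc_vertices_def cyc_sum_def by blast
    have "x = cyc_sum p (restrict a {1..p-1})"
      unfolding x cyc_sum_def by (intro sum.cong) auto
    moreover have "restrict a {1..p-1} \<in> {1..p-1} \<rightarrow>\<^sub>E {- int N, int N}" using a by auto
    ultimately show "x \<in> cyc_sum p ` ({1..p-1} \<rightarrow>\<^sub>E {- int N, int N})" by blast
  qed
qed

lemma inj_on_cyc_sum:
  assumes p: "prime p"
  shows "inj_on (cyc_sum p) ({1..p-1} \<rightarrow>\<^sub>E A)"
proof (rule inj_onI)
  fix a b assume ab: "a \<in> {1..p-1} \<rightarrow>\<^sub>E A" "b \<in> {1..p-1} \<rightarrow>\<^sub>E A" and eq: "cyc_sum p a = cyc_sum p b"
  show "a = b" using cyc_sum_eqD[OF p eq] by (rule PiE_ext[OF ab])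
qed

text \<open>The Euclidean inner product of the \<open>psi\<close> images; reversing the order of the
  coordinates affects both vectors alike.\<close>

definition ctrace_inner :: "nat \<Rightarrow> (nat \<Rightarrow> int) \<Rightarrow> (nat \<Rightarrow> int) \<Rightarrow> real" where
  "ctrace_inner p a b = (\<Sum>j=1..p-1. of_int (ctrace p a j) * of_int (ctrace p b j))"

lemma norm_cyc_sum_sq:
  assumes p: "prime p"
  shows "(norm_cyc p (cyc_sum p a))\<^sup>2 = ctrace_inner p a a"
  unfolding norm_cyc_sum[OF p] ctrace_inner_def
  by (simp add: sum_nonneg power2_eq_square)

lemma dist_cyc_sum_sq:
  assumes p: "prime p"
  shows "(norm_cyc p (cyc_sum p b - cyc_sum p a))\<^sup>2
    = ctrace_inner p a a + ctrace_inner p b b - 2 * ctrace_inner p a b"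
  unfolding cyc_sum_diff[symmetric] norm_cyc_sum_sq[OF p] ctrace_inner_def ctrace_diff
  by (simp add: sum.distrib sum_subtractf sum_distrib_left algebra_simps)

text \<open>The normalising factor of \<open>ndist\<close> cancels, so the law of cosines yields
  inner product over product of norms. The hypothesis is this bound squared and cleared of
  denominators.\<close>

lemma cos_cyc_angle_le:
  assumes p: "prime p" and N: "N \<ge> 1" and e: "0 < e" "e \<le> 1"
    and le: "(ctrace_inner p a b)\<^sup>2 \<le> e\<^sup>2 * (ctrace_inner p a a * ctrace_inner p b b)"
  shows "\<bar>cos (cyc_angle p N (cyc_sum p a) 0 (cyc_sum p b))\<bar> \<le> e"
proof -
  define D where "D = 2 * real N * real p * sqrt (real (p - 1))"
  define x where "x = norm_cyc p (cyc_sum p a)"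
  define y where "y = norm_cyc p (cyc_sum p b)"
  define q where "q = ctrace_inner p a b / (x * y)"
  have D: "D > 0" using N prime_gt_1_nat[OF p] by (simp add: D_def)
  have nd: "ndist p N u v = norm_cyc p (v - u) / D" for u v
    by (simp add: ndist_def dist_cyc_def D_def)
  have xy: "x \<ge> 0" "y \<ge> 0" by (simp_all add: x_def y_def norm_cyc_def)
  have "((ndist p N 0 (cyc_sum p a))\<^sup>2 + (ndist p N 0 (cyc_sum p b))\<^sup>2 - (ndist p N (cyc_sum p a) (cyc_sum p b))\<^sup>2)
      = 2 * ctrace_inner p a b / D\<^sup>2"
    unfolding nd power_divide dist_cyc_sum_sq[OF p]
    by (simp add: norm_cyc_sum_sq[OF p] flip: add_divide_distrib diff_divide_distrib)
  moreover have "2 * ndist p N 0 (cyc_sum p a) * ndist p N 0 (cyc_sum p b) = 2 * (x * y) / D\<^sup>2"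
    unfolding nd by (simp add: x_def y_def power2_eq_square)
  ultimately have angle: "cyc_angle p N (cyc_sum p a) 0 (cyc_sum p b) = arccos q"
    using D unfolding cyc_angle_def q_def by simp
  have "(ctrace_inner p a b)\<^sup>2 \<le> (e * (x * y))\<^sup>2"
    using le unfolding power_mult_distrib x_def y_def norm_cyc_sum_sq[OF p] .
  then have "\<bar>ctrace_inner p a b\<bar>\<^sup>2 \<le> (e * (x * y))\<^sup>2"
    unfolding power2_abs .
  moreover have "e * (x * y) \<ge> 0" using e xy by simp
  ultimately have abs_le: "\<bar>ctrace_inner p a b\<bar> \<le> e * (x * y)"
    by (rule power2_le_imp_le)
  have "\<bar>q\<bar> \<le> e"
  proof (cases "x * y = 0")
    \<comment> \<open>Division by zero gives \<open>q = 0\<close>, so a zero vector satisfies the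
      bound as well.\<close>
    case True
    then show ?thesis unfolding q_def True using e by simp
  next
    case False
    have "x * y \<ge> 0" using xy by simp
    with False have pos: "x * y > 0" by linarith
    have "\<bar>q\<bar> = \<bar>ctrace_inner p a b\<bar> / (x * y)"
      unfolding q_def abs_divide abs_of_pos[OF pos] ..
    also have "\<dots> \<le> e" using abs_le unfolding pos_divide_le_eq[OF pos] .
    finally show ?thesis .
  qed
  \<comment> \<open>By \<open>e \<le> 1\<close>, \<open>q\<close> lies in [-1, 1], where
    \<open>cos\<close> undoes \<open>arccos\<close>.\<close>
  then show ?thesis unfolding angle using e by (simp add: cos_arccos_abs)
qed

text \<open>For fixed \<open>a\<close> this is a linear form in \<open>b\<close>, so the second
  moment bound applies to it; the coordinates \<open>ctrace p a j\<close> sum to the coefficient sum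
  of \<open>a\<close>.\<close>

lemma ctrace_inner_linear:
  assumes p: "p > 0"
  shows "ctrace_inner p a b
    = (\<Sum>j=1..p-1. (real p * of_int (ctrace p a j) - of_int (\<Sum>i=1..p-1. a i)) * of_int (b j))"
proof -
  let ?A = "real_of_int (\<Sum>i=1..p-1. a i)" and ?B = "real_of_int (\<Sum>i=1..p-1. b i)"
  have A: "(\<Sum>j=1..p-1. real_of_int (ctrace p a j)) = ?A"
    using sum_ctrace[OF p, of a] by (simp flip: of_int_sum)
  have "ctrace_inner p a b = real p * (\<Sum>j=1..p-1. of_int (ctrace p a j) * of_int (b j)) - ?A * ?B"
    unfolding ctrace_inner_def A[symmetric] ctrace_def[of p b]
    by (simp add: sum_subtractf sum_distrib_left sum_distrib_right algebra_simps)
  also have "?A * ?B = (\<Sum>j=1..p-1. ?A * of_int (b j))"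
    by (simp add: sum_distrib_left)
  also have "real p * (\<Sum>j=1..p-1. of_int (ctrace p a j) * of_int (b j)) - \<dots>
      = (\<Sum>j=1..p-1. (real p * of_int (ctrace p a j) - ?A) * of_int (b j))"
    by (simp add: sum_subtractf sum_distrib_left algebra_simps)
  finally show ?thesis .
qed

text \<open>Needed twice: with \<open>u\<close> the coefficients of a vertex it gives its norm, and
  with \<open>u\<close> the values \<open>ctrace p a j\<close> it gives the squared coefficients of
  the linear form.\<close>

lemma sum_scaled_minus_total:
  fixes u :: "nat \<Rightarrow> real"
  assumes p: "p > 0"
  defines "S \<equiv> \<Sum>j=1..p-1. u j"
  shows "(\<Sum>j=1..p-1. (real p * u j - S)\<^sup>2) = (real p)\<^sup>2 * (\<Sum>j=1..p-1. (u j)\<^sup>2) - (real p + 1) * S\<^sup>2"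
proof -
  have "(\<Sum>j=1..p-1. (real p * u j - S)\<^sup>2)
      = (\<Sum>j=1..p-1. (real p)\<^sup>2 * (u j)\<^sup>2 - 2 * real p * S * u j + S\<^sup>2)"
    by (intro sum.cong refl) (simp add: power2_eq_square algebra_simps)
  also have "\<dots> = (real p)\<^sup>2 * (\<Sum>j=1..p-1. (u j)\<^sup>2) - 2 * real p * S * S + real (p - 1) * S\<^sup>2"
    by (simp add: sum.distrib sum_subtractf S_def flip: sum_distrib_left)
  also have "\<dots> = (real p)\<^sup>2 * (\<Sum>j=1..p-1. (u j)\<^sup>2) - (real p + 1) * S\<^sup>2"
    using p by (simp add: of_nat_diff power2_eq_square algebra_simps)
  finally show ?thesis .
qed

lemma ctrace_inner_self:
  assumes "p > 0"
  shows "ctrace_inner p b b = (real p)\<^sup>2 * (\<Sum>j=1..p-1. (of_int (b j))\<^sup>2) - (real p + 1) * (\<Sum>j=1..p-1. of_int (b j))\<^sup>2"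
  using sum_scaled_minus_total[OF assms, of "\<lambda>j. of_int (b j)"]
  by (simp add: ctrace_inner_def ctrace_def power2_eq_square)

text \<open>A bad sign vector has a large coefficient sum (\<open>B1\<close>) or a large inner
  product with \<open>a\<close> (\<open>B2\<close>). With \<open>n = p - 1\<close>, Markov bounds
  the two proportions by 4/(e^2 n) and 2/(e^2 n).\<close>

lemma card_bad_vertices:
  assumes p: "prime p" and N: "N \<ge> 1" and e: "0 < e" "e \<le> 1" and large: "6 \<le> e\<^sup>2 * \<delta> * real (p - 1)"
  defines "W \<equiv> {1..p-1} \<rightarrow>\<^sub>E {- int N, int N}"
  shows "real (card {b \<in> W. (ctrace_inner p a b)\<^sup>2 > e\<^sup>2 * (ctrace_inner p a a * ctrace_inner p b b)})
    \<le> 2 ^ (p - 1) * \<delta>"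
proof -
  let ?ip = "ctrace_inner p"
  define n where "n = real (p - 1)"
  define M where "M = (real N)\<^sup>2"
  define c where "c = (\<lambda>j. real p * of_int (ctrace p a j) - of_int (\<Sum>i=1..p-1. a i))"
  \<comment> \<open>\<open>T1\<close> is chosen so that \<open>2 * p * T1\<close> is half of
    \<open>p^2 * n * M\<close>; off \<open>B1\<close> the other half remains as a lower bound for
    \<open>?ip b b\<close>, and \<open>T2\<close> is \<open>e^2 * ?ip a a\<close> times that
    bound.\<close>
  define T1 where "T1 = M * real p * n / 4"
  define T2 where "T2 = e\<^sup>2 * ?ip a a * ((real p)\<^sup>2 * n * M / 2)"
  define B1 where "B1 = {b \<in> W. (\<Sum>j=1..p-1. 1 * real_of_int (b j))\<^sup>2 > T1}"
  define B2 where "B2 = {b \<in> W. (\<Sum>j=1..p-1. c j * real_of_int (b j))\<^sup>2 > T2}"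
  have p1: "p > 1" using prime_gt_1_nat[OF p] .
  have pn: "real p = n + 1" "n \<ge> 1" using p1 by (auto simp: n_def of_nat_diff)
  have M: "M > 0" using N by (simp add: M_def)
  have finW: "finite W" unfolding W_def by (intro finite_PiE) auto
  have aa: "?ip a a \<ge> 0" by (simp add: ctrace_inner_def sum_nonneg)
  have ipab: "?ip a b = (\<Sum>j=1..p-1. c j * of_int (b j))" for b
    using ctrace_inner_linear[of p a b] p1 unfolding c_def by simp
  have sumc: "(\<Sum>j=1..p-1. (c j)\<^sup>2) \<le> (real p)\<^sup>2 * ?ip a a"
  proof -
    have S: "real_of_int (\<Sum>i=1..p-1. a i) = (\<Sum>j=1..p-1. real_of_int (ctrace p a j))"
      using sum_ctrace[of p a] p1 by (simp flip: of_int_sum)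
    \<comment> \<open>The exact value differs from the bound by \<open>p + 1\<close> times a square,
      which is dropped.\<close>
    show ?thesis
      unfolding c_def S using p1
      by (subst sum_scaled_minus_total) (auto simp: ctrace_inner_def power2_eq_square)
  qed
  have "{b \<in> W. (?ip a b)\<^sup>2 > e\<^sup>2 * (?ip a a * ?ip b b)} \<subseteq> B1 \<union> B2"
  proof
    fix b assume b: "b \<in> {b \<in> W. (?ip a b)\<^sup>2 > e\<^sup>2 * (?ip a a * ?ip b b)}"
    show "b \<in> B1 \<union> B2"
    proof (rule ccontr)
      assume not: "b \<notin> B1 \<union> B2"
      have S: "(\<Sum>j=1..p-1. real_of_int (b j))\<^sup>2 \<le> T1" and I: "(?ip a b)\<^sup>2 \<le> T2"
        using b not unfolding B1_def B2_def ipab by auto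
      have "(real_of_int (b j))\<^sup>2 = M" if "j \<in> {1..p-1}" for j
        using b that unfolding W_def M_def by (auto dest!: PiE_mem[of b _ _ j])
      then have "(\<Sum>j=1..p-1. (real_of_int (b j))\<^sup>2) = n * M" by (simp add: n_def)
      then have "?ip b b = (real p)\<^sup>2 * (n * M) - (real p + 1) * (\<Sum>j=1..p-1. real_of_int (b j))\<^sup>2"
        using ctrace_inner_self[of p b] p1 by simp
      \<comment> \<open>Uses \<open>p + 1 \<le> 2 * p\<close>.\<close>
      also have "\<dots> \<ge> (real p)\<^sup>2 * (n * M) - (2 * real p) * T1"
        using S pn by (intro diff_left_mono mult_mono) (auto simp: T1_def)
      finally have "(real p)\<^sup>2 * n * M / 2 \<le> ?ip b b"
        by (simp add: T1_def power2_eq_square algebra_simps)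
      then have "T2 \<le> e\<^sup>2 * ?ip a a * ?ip b b"
        unfolding T2_def using aa by (intro mult_left_mono) auto
      then show False using I b by (simp add: mult.assoc)
    qed
  qed
  then have "card {b \<in> W. (?ip a b)\<^sup>2 > e\<^sup>2 * (?ip a a * ?ip b b)} \<le> card (B1 \<union> B2)"
    using finW by (intro card_mono) (auto simp: B1_def B2_def)
  also have "\<dots> \<le> card B1 + card B2" by (rule card_Un_le)
  finally have "real (card {b \<in> W. (?ip a b)\<^sup>2 > e\<^sup>2 * (?ip a a * ?ip b b)}) \<le> real (card B1) + real (card B2)"
    by linarith
  also have "real (card B1) \<le> 2 ^ (p - 1) * (4 / (e\<^sup>2 * n))"
  proof -
    have "T1 > 0" using pn M by (simp add: T1_def)
    have "real (card B1) \<le> 2 ^ card {1..p-1} * ((real_of_int (int N))\<^sup>2 * (\<Sum>j=1..p-1. 1\<^sup>2) / T1)"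
      unfolding B1_def W_def using N \<open>T1 > 0\<close> by (intro card_PiE_signs_large) auto
    also have "\<dots> = 2 ^ (p - 1) * (M * n / T1)" by (simp add: M_def n_def)
    also have "M * n / T1 = 4 / real p" using M pn(2) p1 by (simp add: T1_def)
    \<comment> \<open>Weakened to share its denominator with the bound for
      \<open>B2\<close>.\<close>
    also have "\<dots> \<le> 4 / (e\<^sup>2 * n)"
    proof -
      have "e\<^sup>2 * n \<le> 1 * n" using e pn by (intro mult_right_mono) (auto simp: power_le_one)
      then have "e\<^sup>2 * n \<le> real p" using pn(1) by linarith
      moreover have "e\<^sup>2 * n > 0" using pn(2) e by simp
      ultimately show ?thesis by (intro divide_left_mono) auto
    qed
    finally show ?thesis by simp
  qed
  also have "real (card B2) \<le> 2 ^ (p - 1) * (2 / (e\<^sup>2 * n))"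
  proof (cases "?ip a a = 0")
    case True
    then have "ctrace p a j = 0" if "j \<in> {1..p-1}" for j
      using that unfolding ctrace_inner_def by (subst (asm) sum_nonneg_eq_0_iff) auto
    then have "?ip a b = 0" for b unfolding ctrace_inner_def by (intro sum.neutral) auto
    then have "B2 = {}" unfolding B2_def ipab[symmetric] T2_def using True by simp
    then show ?thesis using pn by simp
  next
    case False
    then have "T2 > 0" using aa e M pn by (simp add: T2_def)
    have "real (card B2) \<le> 2 ^ card {1..p-1} * ((real_of_int (int N))\<^sup>2 * (\<Sum>j=1..p-1. (c j)\<^sup>2) / T2)"
      unfolding B2_def W_def using N \<open>T2 > 0\<close> by (intro card_PiE_signs_large) auto
    also have "\<dots> = 2 ^ (p - 1) * (M * (\<Sum>j=1..p-1. (c j)\<^sup>2) / T2)" by (simp add: M_def)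
    also have "\<dots> \<le> 2 ^ (p - 1) * (M * ((real p)\<^sup>2 * ?ip a a) / T2)"
      using sumc M \<open>T2 > 0\<close> by (intro mult_left_mono divide_right_mono) auto
    \<comment> \<open>The norm of \<open>a\<close> cancels, so the bound is uniform in
      \<open>a\<close>.\<close>
    also have "M * ((real p)\<^sup>2 * ?ip a a) / T2 = 2 / (e\<^sup>2 * n)"
      using M pn(2) p1 e False by (simp add: T2_def)
    finally show ?thesis .
  qed
  also have "2 ^ (p - 1) * (4 / (e\<^sup>2 * n)) + 2 ^ (p - 1) * (2 / (e\<^sup>2 * n)) = 2 ^ (p - 1) * (6 / (e\<^sup>2 * n))"
    by (subst distrib_left[symmetric], subst add_divide_distrib[symmetric]) simp
  also have "\<dots> \<le> 2 ^ (p - 1) * \<delta>"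
    using large e pn unfolding n_def[symmetric] by (intro mult_left_mono) (simp_all add: divide_le_eq mult_ac)
  finally show ?thesis by simp
qed

text \<open>A vertex with too large a cosine comes from a bad sign vector, and injectivity of
  \<open>cyc_sum\<close> on sign vectors makes the number of vertices
  \<open>2 ^ (p - 1)\<close>.\<close>

lemma card_nearly_orthogonal_vertices:
  assumes p: "prime p" and N: "N \<ge> 1" and e: "0 < e" "e \<le> 1" and large: "6 \<le> e\<^sup>2 * \<delta> * real (p - 1)"
    and \<alpha>: "\<alpha> \<in> cyc_box p N"
  shows "real (card {\<beta> \<in> cyc_vertices p N. \<bar>cos (cyc_angle p N \<alpha> 0 \<beta>)\<bar> \<le> e})
    / real (card (cyc_vertices p N)) \<ge> 1 - \<delta>"
proof -
  define W where "W = {1..p-1} \<rightarrow>\<^sub>E {- int N, int N}"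
  obtain a where a: "\<alpha> = cyc_sum p a" using \<alpha> unfolding cyc_box_def cyc_sum_def by blast
  define bad where "bad = {b \<in> W. (ctrace_inner p a b)\<^sup>2 > e\<^sup>2 * (ctrace_inner p a a * ctrace_inner p b b)}"
  define V where "V = cyc_vertices p N"
  define G where "G = {\<beta> \<in> V. \<bar>cos (cyc_angle p N \<alpha> 0 \<beta>)\<bar> \<le> e}"
  have finW: "finite W" unfolding W_def by (intro finite_PiE) auto
  have V: "V = cyc_sum p ` W" unfolding V_def W_def by (rule cyc_vertices_eq)
  have "card {- int N, int N} = 2" using N by simp
  then have "card W = 2 ^ (p - 1)" unfolding W_def by (simp only: card_funcsetE finite_atLeastAtMost card_atLeastAtMost) simp
  then have cardV: "card V = 2 ^ (p - 1)"
    unfolding V using inj_on_cyc_sum[OF p] by (simp add: card_image W_def)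
  have "V - G \<subseteq> cyc_sum p ` bad"
    using cos_cyc_angle_le[OF p N e, of a] unfolding V G_def bad_def a by force
  then have "card (V - G) \<le> card (cyc_sum p ` bad)"
    using finW by (intro card_mono) (auto simp: bad_def)
  also have "\<dots> \<le> card bad" using finW by (intro card_image_le) (auto simp: bad_def)
  finally have bound: "real (card (V - G)) \<le> 2 ^ (p - 1) * \<delta>"
    using card_bad_vertices[OF p N e large, of a] unfolding bad_def W_def by linarith
  have split: "card V = card G + card (V - G)"
    using finW by (subst card_Un_disjoint[symmetric]) (auto simp: V G_def intro: arg_cong[of _ _ card])
  have "2 ^ (p - 1) = real (card G) + real (card (V - G))"
    using arg_cong[OF split, of real] unfolding cardV by simp
  then have "2 ^ (p - 1) * (1 - \<delta>) \<le> real (card G)"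
    using bound unfolding right_diff_distrib by linarith
  then show ?thesis
    unfolding V_def[symmetric] G_def[symmetric] cardV by (simp add: le_divide_eq mult.commute)
qed

theorem theorem2:
  shows "\<forall>\<epsilon>::real. \<epsilon> > 0 \<longrightarrow>
    (\<exists>(p\<^sub>0::nat) (f :: nat \<Rightarrow> real). prime p\<^sub>0 \<and>
       (\<forall>p. prime p \<longrightarrow> f p \<le> 1 / 2) \<and>
       (f \<longlongrightarrow> 0) (inf at_top (principal {p. prime p})) \<and>
       (\<forall>p N \<alpha>. prime p \<longrightarrow> p \<ge> p\<^sub>0 \<longrightarrow> N \<ge> 1 \<longrightarrow> \<alpha> \<in> cyc_box p N \<longrightarrow> ndist p N \<alpha> 0 \<ge> f p \<longrightarrow>
          real (card {\<beta> \<in> cyc_vertices p N. \<bar>cos (cyc_angle p N \<alpha> 0 \<beta>)\<bar> \<le> \<epsilon>})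
            / real (card (cyc_vertices p N)) \<ge> 1 - \<epsilon>))"
proof (intro allI impI)
  fix \<epsilon> :: real assume \<epsilon>: "\<epsilon> > 0"
  \<comment> \<open>The counting needs a cosine bound of at most 1; relaxing \<open>e\<close> to
    \<open>\<epsilon>\<close> afterwards only enlarges the set of vertices.\<close>
  define e where "e = min \<epsilon> 1"
  have e: "0 < e" "e \<le> 1" "e \<le> \<epsilon>" using \<epsilon> by (auto simp: e_def)
  obtain m :: nat where m: "real m \<ge> 6 / (e\<^sup>2 * \<epsilon>)" using real_arch_simple by blast
  obtain p0 where p0: "prime p0" "p0 > m" using bigger_prime by blast
  have main: "real (card {\<beta> \<in> cyc_vertices p N. \<bar>cos (cyc_angle p N \<alpha> 0 \<beta>)\<bar> \<le> \<epsilon>})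
      / real (card (cyc_vertices p N)) \<ge> 1 - \<epsilon>"
    if p: "prime p" "p \<ge> p0" and N: "N \<ge> 1" and \<alpha>: "\<alpha> \<in> cyc_box p N" for p N \<alpha>
  proof -
    \<comment> \<open>The strict inequality \<open>p0 > m\<close> absorbs the 1 in
      \<open>p - 1\<close>.\<close>
    have "6 / (e\<^sup>2 * \<epsilon>) \<le> real (p - 1)" using m p p0 by simp
    then have "6 \<le> e\<^sup>2 * \<epsilon> * real (p - 1)" using e \<epsilon> by (subst (asm) pos_divide_le_eq) (simp_all only: mult_ac zero_less_power mult_pos_pos)
    from card_nearly_orthogonal_vertices[OF p(1) N e(1,2) this \<alpha>]
    have "1 - \<epsilon> \<le> real (card {\<beta> \<in> cyc_vertices p N. \<bar>cos (cyc_angle p N \<alpha> 0 \<beta>)\<bar> \<le> e})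
      / real (card (cyc_vertices p N))" .
    also have "\<dots> \<le> real (card {\<beta> \<in> cyc_vertices p N. \<bar>cos (cyc_angle p N \<alpha> 0 \<beta>)\<bar> \<le> \<epsilon>})
      / real (card (cyc_vertices p N))"
    proof -
      have "finite (cyc_vertices p N)" unfolding cyc_vertices_eq by (intro finite_imageI finite_PiE) auto
      then show ?thesis using e by (intro divide_right_mono of_nat_mono card_mono) auto
    qed
    finally show ?thesis .
  qed
  \<comment> \<open>The threshold \<open>f = 0\<close> suffices: only \<open>\<alpha> = 0\<close> could be exceptional, and there every angle is
    \<open>\<pi>/2\<close> by the division-by-zero convention.\<close>
  show "\<exists>(p\<^sub>0::nat) (f :: nat \<Rightarrow> real). prime p\<^sub>0 \<and>
       (\<forall>p. prime p \<longrightarrow> f p \<le> 1 / 2) \<and>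
       (f \<longlongrightarrow> 0) (inf at_top (principal {p. prime p})) \<and>
       (\<forall>p N \<alpha>. prime p \<longrightarrow> p \<ge> p\<^sub>0 \<longrightarrow> N \<ge> 1 \<longrightarrow> \<alpha> \<in> cyc_box p N \<longrightarrow> ndist p N \<alpha> 0 \<ge> f p \<longrightarrow>
          real (card {\<beta> \<in> cyc_vertices p N. \<bar>cos (cyc_angle p N \<alpha> 0 \<beta>)\<bar> \<le> \<epsilon>})
            / real (card (cyc_vertices p N)) \<ge> 1 - \<epsilon>)"
    by (rule exI[of _ p0], rule exI[of _ "\<lambda>_. 0"]) (use p0(1) main in simp)
qed

end
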